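(* Let $G$ and $G'$ be finite groups, suppose that $U$ is a $(G,G')$-transformation matrix, and let $S\subseteq G$ and $S'\subseteq G'$ be the sets of indices of all of the rows, respectively columns, of $U$ that have a single nonzero entry. Define $\sigma:S\to S'$, $\chi:S\to\mathbb{C}$ and $\chi':S'\to\mathbb{C}$ by $$U_{a,\sigma(a)}\neq 0,\qquad \chi(a)=U_{a,\sigma(a)},\qquad \chi'(b)=U_{\sigma^{-1}(b),b}\qquad (a\in S,\ b\in S').$$ Then $S$ and $S'$ are subgroups of $G$ and $G'$ respectively, $\sigma$ is an isomorphism of these subgroups, and $\chi$, $\chi'$ are linear characters of $S$, $S'$ respectively.
   Context: A matrix $U\in\mathbb{C}^{G\times G'}$ (rows indexed by $G$, columns by $G'$) is a $(G,G')$-transformation matrix if (1) $U$ is unitary; (2) $\overline{U_{a,b}}=U_{a^{-1},b^{-1}}$ for all $a\in G$, $b\in G'$; and (3) $U_{ab,c}=\sum_{x,y\in G',\,xy=c}U_{a,x}U_{b,y}$ for all $a,b\in G$, $c\in G'$. Since $U$ is unitary, a row (column) with a single nonzero entry has that entry of modulus 1, so the corresponding column (row) also has a single nonzero entry; hence $\sigma$ is a well-defined bijection $S\to S'$. A linear character of a group is the character of a degree one complex representation, i.e. a homomorphism to $\mathbb{C}^\times$. *)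

theory Defs
  imports Complex_Main "HOL-Algebra.Group"
begin

text \<open>
  A complex matrix with rows indexed by a finite set \<open>I\<close> and columns indexed by a finite set \<open>J\<close>
  is a function \<open>U :: 'a \<Rightarrow> 'b \<Rightarrow> complex\<close> of which only the values on \<open>I \<times> J\<close> matter.
  Unitarity is \<open>U U\<^sup>* = 1\<close> and \<open>U\<^sup>* U = 1\<close>; both are required, as \<open>I\<close> and \<open>J\<close> are different
  index sets that are not assumed to have the same size.
\<close>

definition unitary_on :: "'a set \<Rightarrow> 'b set \<Rightarrow> ('a \<Rightarrow> 'b \<Rightarrow> complex) \<Rightarrow> bool" where
  "unitary_on I J U \<longleftrightarrow>
     (\<forall>a\<in>I. \<forall>b\<in>I. (\<Sum>x\<in>J. U a x * cnj (U b x)) = (if a = b then 1 else 0)) \<and>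
     (\<forall>x\<in>J. \<forall>y\<in>J. (\<Sum>a\<in>I. cnj (U a x) * U a y) = (if x = y then 1 else 0))"

definition transformation_matrix ::
  "('a, 'm) monoid_scheme \<Rightarrow> ('b, 'n) monoid_scheme \<Rightarrow> ('a \<Rightarrow> 'b \<Rightarrow> complex) \<Rightarrow> bool" where
  "transformation_matrix G G' U \<longleftrightarrow>
     unitary_on (carrier G) (carrier G') U \<and>
     (\<forall>a\<in>carrier G. \<forall>b\<in>carrier G'. cnj (U a b) = U (inv\<^bsub>G\<^esub> a) (inv\<^bsub>G'\<^esub> b)) \<and>
     (\<forall>a\<in>carrier G. \<forall>b\<in>carrier G. \<forall>c\<in>carrier G'.
        U (a \<otimes>\<^bsub>G\<^esub> b) c =
          (\<Sum>(x, y)\<in>{(x, y). x \<in> carrier G' \<and> y \<in> carrier G' \<and> x \<otimes>\<^bsub>G'\<^esub> y = c}. U a x * U b y))"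

definition single_rows ::
  "('a, 'm) monoid_scheme \<Rightarrow> ('b, 'n) monoid_scheme \<Rightarrow> ('a \<Rightarrow> 'b \<Rightarrow> complex) \<Rightarrow> 'a set" where
  "single_rows G G' U = {a \<in> carrier G. \<exists>!b. b \<in> carrier G' \<and> U a b \<noteq> 0}"

definition single_cols ::
  "('a, 'm) monoid_scheme \<Rightarrow> ('b, 'n) monoid_scheme \<Rightarrow> ('a \<Rightarrow> 'b \<Rightarrow> complex) \<Rightarrow> 'b set" where
  "single_cols G G' U = {b \<in> carrier G'. \<exists>!a. a \<in> carrier G \<and> U a b \<noteq> 0}"

text \<open>
  The following three functions are meaningful only on the sets \<open>single_rows G G' U\<close> and
  \<open>single_cols G G' U\<close>; their values elsewhere are arbitrary.
\<close>

definition row_map ::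
  "('a, 'm) monoid_scheme \<Rightarrow> ('b, 'n) monoid_scheme \<Rightarrow> ('a \<Rightarrow> 'b \<Rightarrow> complex) \<Rightarrow> 'a \<Rightarrow> 'b" where
  "row_map G G' U a = (THE b. b \<in> single_cols G G' U \<and> U a b \<noteq> 0)"

definition row_char ::
  "('a, 'm) monoid_scheme \<Rightarrow> ('b, 'n) monoid_scheme \<Rightarrow> ('a \<Rightarrow> 'b \<Rightarrow> complex) \<Rightarrow> 'a \<Rightarrow> complex" where
  "row_char G G' U a = U a (row_map G G' U a)"

definition col_char ::
  "('a, 'm) monoid_scheme \<Rightarrow> ('b, 'n) monoid_scheme \<Rightarrow> ('a \<Rightarrow> 'b \<Rightarrow> complex) \<Rightarrow> 'b \<Rightarrow> complex" where
  "col_char G G' U b = U (inv_into (single_rows G G' U) (row_map G G' U) b) b"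

definition complex_mult_group :: "complex monoid" where
  "complex_mult_group = \<lparr>carrier = - {0}, monoid.mult = (*), one = 1\<rparr>"

definition linear_character :: "('a, 'm) monoid_scheme \<Rightarrow> ('a \<Rightarrow> complex) \<Rightarrow> bool" where
  "linear_character H \<chi> \<longleftrightarrow> \<chi> \<in> hom H complex_mult_group"

end

theory Submission
  imports Defs
begin

text \<open>
  Condition (3) says that the row of \<open>a b\<close> is the convolution on \<open>G'\<close> of the rows of \<open>a\<close> and \<open>b\<close>,
  so the product of two rows supported at the points \<open>x\<close> and \<open>y\<close> is supported at \<open>x y\<close>.
  The row of \<open>1\<close> is a left unit for convolution with every row; since the rows span \<open>\<complex>\<^sup>G\<^sup>'\<close>, it is the
  indicator of \<open>1\<close>.  Orthogonality of rows and of columns makes \<open>\<sigma>\<close> a bijection.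
\<close>

section \<open>Orthogonality and isolated nonzero entries\<close>

lemma unitary_on_adjoint:
  assumes "unitary_on I J U"
  shows "unitary_on J I (\<lambda>x a. cnj (U a x))"
  using assms unfolding unitary_on_def by simp

text \<open>Only one term of the inner product of rows \<open>a\<close> and \<open>a'\<close>
  survives, namely \<open>U a b * cnj (U a' b)\<close>. Orthogonality makes it zero, and its first
  factor is nonzero.\<close>

lemma unitary_on_single_entry:
  assumes U: "unitary_on I J U" and "finite J"
    and a: "a \<in> I" "b \<in> J" "U a b \<noteq> 0" and single: "\<And>y. y \<in> J \<Longrightarrow> y \<noteq> b \<Longrightarrow> U a y = 0"
    and a': "a' \<in> I" "a' \<noteq> a"
  shows "U a' b = 0"
proof -
  have "0 = (\<Sum>x\<in>J. U a x * cnj (U a' x))"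
    using U a a' unfolding unitary_on_def by auto
  also have "\<dots> = (\<Sum>x\<in>{b}. U a x * cnj (U a' x))"
    using assms by (intro sum.mono_neutral_right) auto
  finally show ?thesis
    using a by simp
qed

locale transformation = G: group G + G': group G'
  for G :: "('a, 'm) monoid_scheme" (structure)
    and G' :: "('b, 'n) monoid_scheme" (structure) +
  fixes U :: "'a \<Rightarrow> 'b \<Rightarrow> complex"
  assumes fin: "finite (carrier G)" and fin': "finite (carrier G')"
    and trans: "transformation_matrix G G' U"
begin

abbreviation "S \<equiv> single_rows G G' U"
abbreviation "S' \<equiv> single_cols G G' U"
abbreviation "\<sigma> \<equiv> row_map G G' U"
abbreviation "\<chi> \<equiv> row_char G G' U"

section \<open>Matrix conditions and the row of the identity\<close>

lemma unitary: "unitary_on (carrier G) (carrier G') U"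
  using trans unfolding transformation_matrix_def by blast

lemma cnj_entry:
  assumes "a \<in> carrier G" "b \<in> carrier G'"
  shows "cnj (U a b) = U (inv\<^bsub>G\<^esub> a) (inv\<^bsub>G'\<^esub> b)"
  using trans assms unfolding transformation_matrix_def by blast

text \<open>The constraint \<open>x y = c\<close> determines \<open>y\<close> as
  \<open>x^-1 c\<close>, so the sum over pairs becomes a convolution sum over one index.\<close>

lemma mult_entry:
  assumes "a \<in> carrier G" "b \<in> carrier G" and c: "c \<in> carrier G'"
  shows "U (a \<otimes>\<^bsub>G\<^esub> b) c = (\<Sum>x\<in>carrier G'. U a x * U b (inv\<^bsub>G'\<^esub> x \<otimes>\<^bsub>G'\<^esub> c))"
proof -
  have "U (a \<otimes>\<^bsub>G\<^esub> b) c =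
      (\<Sum>(x, y)\<in>{(x, y). x \<in> carrier G' \<and> y \<in> carrier G' \<and> x \<otimes>\<^bsub>G'\<^esub> y = c}. U a x * U b y)"
    using trans assms unfolding transformation_matrix_def by blast
  also have "\<dots> = (\<Sum>x\<in>carrier G'. U a x * U b (inv\<^bsub>G'\<^esub> x \<otimes>\<^bsub>G'\<^esub> c))"
    by (rule sum.reindex_bij_witness[where i = "\<lambda>x. (x, inv\<^bsub>G'\<^esub> x \<otimes>\<^bsub>G'\<^esub> c)" and j = fst])
      (use c in \<open>auto simp: G'.inv_solve_left' G'.m_assoc[symmetric]\<close>)
  finally show ?thesis .
qed

text \<open>Combine all rows \<open>b\<close> with coefficients \<open>cnj (U b 1)\<close>: by
  column orthogonality this gives the indicator of the identity of \<open>G'\<close>. Convolving row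
  \<open>1\<close> with it leaves the indicator fixed, since \<open>1 b = b\<close> for every row,
  but also returns row \<open>1\<close>, since the indicator is the unit of convolution.\<close>

lemma one_entry:
  assumes c: "c \<in> carrier G'"
  shows "U \<one>\<^bsub>G\<^esub> c = (if c = \<one>\<^bsub>G'\<^esub> then 1 else 0)"
proof -
  have col: "(\<Sum>b\<in>carrier G. cnj (U b x) * U b y) = (if x = y then 1 else 0)"
    if "x \<in> carrier G'" "y \<in> carrier G'" for x y
    using unitary that unfolding unitary_on_def by blast
  \<comment> \<open>Each \<open>b\<close> is written as \<open>1 b\<close> so that
    \<open>mult_entry\<close> can bring in row \<open>1\<close>.\<close>
  have "(if c = \<one>\<^bsub>G'\<^esub> then 1 else 0) = (\<Sum>b\<in>carrier G. cnj (U b \<one>\<^bsub>G'\<^esub>) * U (\<one>\<^bsub>G\<^esub> \<otimes>\<^bsub>G\<^esub> b) c)"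
    using col[of "\<one>\<^bsub>G'\<^esub>" c] c by auto
  also have "\<dots> = (\<Sum>b\<in>carrier G. \<Sum>x\<in>carrier G'.
      U \<one>\<^bsub>G\<^esub> x * (cnj (U b \<one>\<^bsub>G'\<^esub>) * U b (inv\<^bsub>G'\<^esub> x \<otimes>\<^bsub>G'\<^esub> c)))"
    by (intro sum.cong refl)
      (simp only: mult_entry[OF G.one_closed _ c] sum_distrib_left mult_ac)
  also have "\<dots> = (\<Sum>x\<in>carrier G'. U \<one>\<^bsub>G\<^esub> x *
      (\<Sum>b\<in>carrier G. cnj (U b \<one>\<^bsub>G'\<^esub>) * U b (inv\<^bsub>G'\<^esub> x \<otimes>\<^bsub>G'\<^esub> c)))"
    by (subst sum.swap) (simp add: sum_distrib_left)
  also have "\<dots> = (\<Sum>x\<in>carrier G'. if x = c then U \<one>\<^bsub>G\<^esub> x else 0)"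
  proof (intro sum.cong refl)
    fix x assume x: "x \<in> carrier G'"
    \<comment> \<open>The inner sum pairs column \<open>1\<close> with column \<open>x^-1 c\<close>,
      so orthogonality keeps only \<open>x = c\<close>.\<close>
    then have "\<one>\<^bsub>G'\<^esub> = inv\<^bsub>G'\<^esub> x \<otimes>\<^bsub>G'\<^esub> c \<longleftrightarrow> x = c"
      using c by (auto simp: G'.inv_solve_left)
    then show "U \<one>\<^bsub>G\<^esub> x * (\<Sum>b\<in>carrier G. cnj (U b \<one>\<^bsub>G'\<^esub>) * U b (inv\<^bsub>G'\<^esub> x \<otimes>\<^bsub>G'\<^esub> c)) =
        (if x = c then U \<one>\<^bsub>G\<^esub> x else 0)"
      using x c by (simp add: col)
  qed
  also have "\<dots> = U \<one>\<^bsub>G\<^esub> c"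
    using c fin' by simp
  finally show ?thesis ..
qed

section \<open>Single-entry rows and columns, and the bijection \<sigma>\<close>

lemma single_colsI:
  assumes "a \<in> S" "b \<in> carrier G'" "U a b \<noteq> 0"
  shows "b \<in> S'"
proof -
  have "U a' b = 0" if "a' \<in> carrier G" "a' \<noteq> a" for a'
    using unitary_on_single_entry[OF unitary fin', of a b a'] assms that
    unfolding single_rows_def by auto
  then show ?thesis
    using assms unfolding single_rows_def single_cols_def by blast
qed

lemma single_rowsI:
  assumes "b \<in> S'" "a \<in> carrier G" "U a b \<noteq> 0"
  shows "a \<in> S"
proof -
  \<comment> \<open>Columns of \<open>U\<close> are, up to conjugation, rows of the conjugate
    transpose, so row orthogonality there serves here.\<close>
  have "U a b' = 0" if "b' \<in> carrier G'" "b' \<noteq> b" for b'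
    using unitary_on_single_entry[OF unitary_on_adjoint[OF unitary] fin, of b a b'] assms that
    unfolding single_cols_def by auto
  then show ?thesis
    using assms unfolding single_rows_def single_cols_def by blast
qed

lemma single_rows_carrier: "a \<in> S \<Longrightarrow> a \<in> carrier G"
  unfolding single_rows_def by blast

lemma single_cols_carrier: "b \<in> S' \<Longrightarrow> b \<in> carrier G'"
  unfolding single_cols_def by blast

text \<open>\<open>row_map\<close> chooses within \<open>S'\<close>; by \<open>single_colsI\<close>
  any nonzero position of a row in \<open>S\<close> already lies there, so exhibiting one in the
  carrier suffices.\<close>

lemma row_map_eqI:
  assumes "a \<in> S" "b \<in> carrier G'" "U a b \<noteq> 0"
  shows "\<sigma> a = b"
  unfolding row_map_def
proof (rule the_equality)
  show "b \<in> S' \<and> U a b \<noteq> 0"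
    using assms single_colsI by blast
  show "b' = b" if "b' \<in> S' \<and> U a b' \<noteq> 0" for b'
    using assms that single_cols_carrier unfolding single_rows_def by blast
qed

lemma row_map_in_single_cols: "a \<in> S \<Longrightarrow> \<sigma> a \<in> S'"
  and row_char_nonzero: "a \<in> S \<Longrightarrow> \<chi> a \<noteq> 0"
proof -
  assume a: "a \<in> S"
  then obtain b where b: "b \<in> carrier G'" "U a b \<noteq> 0"
    unfolding single_rows_def by blast
  show "\<sigma> a \<in> S'" "\<chi> a \<noteq> 0"
    using row_map_eqI[OF a b] single_colsI[OF a b] b unfolding row_char_def by auto
qed

lemma row_map_carrier: "a \<in> S \<Longrightarrow> \<sigma> a \<in> carrier G'"
  by (simp add: row_map_in_single_cols single_cols_carrier)

lemma single_row_entry: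
  assumes "a \<in> S" "x \<in> carrier G'"
  shows "U a x = (if x = \<sigma> a then \<chi> a else 0)"
  using assms row_map_eqI unfolding row_char_def by auto

text \<open>Common exit for the identity, products and inverses: once a row is exhibited as a
  nonzero multiple of a point mass, membership, \<sigma> and \<chi> are read off from it.\<close>

lemma single_rowI:
  assumes "a \<in> carrier G" "b \<in> carrier G'" "c \<noteq> 0"
    and row: "\<And>x. x \<in> carrier G' \<Longrightarrow> U a x = (if x = b then c else 0)"
  shows "a \<in> S" "\<sigma> a = b" "\<chi> a = c"
proof -
  show a: "a \<in> S"
    unfolding single_rows_def using assms by (auto split: if_splits)
  show "\<sigma> a = b"
    using assms by (intro row_map_eqI[OF a]) auto
  then show "\<chi> a = c"
    using assms unfolding row_char_def by auto
qed

lemma bij_betw_row_map: "bij_betw \<sigma> S S'"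
  unfolding bij_betw_def
proof
  show "inj_on \<sigma> S"
  proof (rule inj_onI)
    fix a b assume ab: "a \<in> S" "b \<in> S" "\<sigma> a = \<sigma> b"
    then have "U a (\<sigma> a) \<noteq> 0" "U b (\<sigma> a) \<noteq> 0"
      using row_char_nonzero[of a] row_char_nonzero[of b] unfolding row_char_def by auto
    \<comment> \<open>Column \<open>\<sigma> a\<close> lies in \<open>S'\<close>, and both
      \<open>a\<close> and \<open>b\<close> index a nonzero entry of it.\<close>
    then show "a = b"
      using ab row_map_in_single_cols[of a] single_rows_carrier unfolding single_cols_def by blast
  qed
  show "\<sigma> ` S = S'"
  proof
    show "\<sigma> ` S \<subseteq> S'"
      using row_map_in_single_cols by blast
    show "S' \<subseteq> \<sigma> ` S"
    proof
      fix b assume b: "b \<in> S'"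
      then obtain a where "a \<in> carrier G" "U a b \<noteq> 0"
        unfolding single_cols_def by blast
      then show "b \<in> \<sigma> ` S"
        using b single_rowsI single_cols_carrier row_map_eqI by (metis imageI)
    qed
  qed
qed

section \<open>Closure of \<open>S\<close> under the group operations\<close>

lemma one_in_single_rows: "\<one>\<^bsub>G\<^esub> \<in> S"
  using single_rowI[OF G.one_closed G'.one_closed _ one_entry] by simp

text \<open>Convolving \<open>\<chi> a\<close> times the point mass at \<open>\<sigma> a\<close>
  with \<open>\<chi> b\<close> times that at \<open>\<sigma> b\<close> gives
  \<open>\<chi> a * \<chi> b\<close> times the point mass at the product. All three claims are read
  off from this row.\<close>

lemma mult_in_single_rows: "\<lbrakk>a \<in> S; b \<in> S\<rbrakk> \<Longrightarrow> a \<otimes>\<^bsub>G\<^esub> b \<in> S"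
  and row_map_mult: "\<lbrakk>a \<in> S; b \<in> S\<rbrakk> \<Longrightarrow> \<sigma> (a \<otimes>\<^bsub>G\<^esub> b) = \<sigma> a \<otimes>\<^bsub>G'\<^esub> \<sigma> b"
  and row_char_mult: "\<lbrakk>a \<in> S; b \<in> S\<rbrakk> \<Longrightarrow> \<chi> (a \<otimes>\<^bsub>G\<^esub> b) = \<chi> a * \<chi> b"
proof -
  assume a: "a \<in> S" and b: "b \<in> S"
  have row: "U (a \<otimes>\<^bsub>G\<^esub> b) c = (if c = \<sigma> a \<otimes>\<^bsub>G'\<^esub> \<sigma> b then \<chi> a * \<chi> b else 0)"
    if c: "c \<in> carrier G'" for c
  proof -
    have "U (a \<otimes>\<^bsub>G\<^esub> b) c = (\<Sum>x\<in>carrier G'. U a x * U b (inv\<^bsub>G'\<^esub> x \<otimes>\<^bsub>G'\<^esub> c))"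
      using a b c by (simp add: mult_entry single_rows_carrier)
    also have "\<dots> = (\<Sum>x\<in>carrier G'. if x = \<sigma> a then \<chi> a * U b (inv\<^bsub>G'\<^esub> x \<otimes>\<^bsub>G'\<^esub> c) else 0)"
      using a by (intro sum.cong) (auto simp: single_row_entry)
    also have "\<dots> = \<chi> a * U b (inv\<^bsub>G'\<^esub> (\<sigma> a) \<otimes>\<^bsub>G'\<^esub> c)"
      using a fin' by (simp add: row_map_carrier)
    also have "\<dots> = (if inv\<^bsub>G'\<^esub> (\<sigma> a) \<otimes>\<^bsub>G'\<^esub> c = \<sigma> b then \<chi> a * \<chi> b else 0)"
      using a b c by (simp add: single_row_entry row_map_carrier)
    finally show ?thesis
      using a b c by (simp add: G'.inv_solve_left' row_map_carrier)
  qed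
  show "a \<otimes>\<^bsub>G\<^esub> b \<in> S" "\<sigma> (a \<otimes>\<^bsub>G\<^esub> b) = \<sigma> a \<otimes>\<^bsub>G'\<^esub> \<sigma> b" "\<chi> (a \<otimes>\<^bsub>G\<^esub> b) = \<chi> a * \<chi> b"
    using single_rowI[OF _ _ _ row] a b
    by (simp_all add: single_rows_carrier row_map_carrier row_char_nonzero)
qed

text \<open>By condition (2), the row of \<open>a^-1\<close> is the conjugate of row
  \<open>a\<close> with column indices inverted, hence again a multiple of a point mass.\<close>

lemma inv_in_single_rows:
  assumes a: "a \<in> S"
  shows "inv\<^bsub>G\<^esub> a \<in> S"
proof (rule single_rowI)
  show "U (inv\<^bsub>G\<^esub> a) x = (if x = inv\<^bsub>G'\<^esub> (\<sigma> a) then cnj (\<chi> a) else 0)"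
    if x: "x \<in> carrier G'" for x
  proof -
    have "U (inv\<^bsub>G\<^esub> a) x = cnj (U a (inv\<^bsub>G'\<^esub> x))"
      using a x by (simp add: cnj_entry single_rows_carrier)
    moreover have "inv\<^bsub>G'\<^esub> x = \<sigma> a \<longleftrightarrow> x = inv\<^bsub>G'\<^esub> (\<sigma> a)"
      using a x row_map_carrier G'.inv_inv by metis
    ultimately show ?thesis
      using a x by (simp add: single_row_entry)
  qed
qed (use a in \<open>simp_all add: single_rows_carrier row_map_carrier row_char_nonzero\<close>)

section \<open>Subgroups, isomorphism and characters\<close>

lemma subgroup_single_rows: "subgroup S G"
  by (rule G.subgroupI)
    (use one_in_single_rows mult_in_single_rows inv_in_single_rows single_rows_carrier in auto)

lemma row_map_iso: "\<sigma> \<in> iso (G\<lparr>carrier := S\<rparr>) (G'\<lparr>carrier := S'\<rparr>)"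
  using bij_betw_row_map row_map_in_single_cols row_map_mult unfolding iso_def hom_def by auto

text \<open>Condition (3) multiplies rows, not columns, so the subgroup property is transported:
  \<open>S'\<close> is the image of \<open>S\<close> under the homomorphism \<sigma>.\<close>

lemma subgroup_single_cols: "subgroup S' G'"
proof -
  \<comment> \<open>The target is all of \<open>G'\<close>, since \<open>S'\<close> is not yet known
    to be a group.\<close>
  have "group_hom (G\<lparr>carrier := S\<rparr>) G' \<sigma>"
    using subgroup_single_rows row_map_carrier row_map_mult
    by (auto simp: group_hom_def group_hom_axioms_def hom_def
        intro: G.subgroup_imp_group G'.is_group)
  then have "subgroup (\<sigma> ` S) G'"
    using group_hom.img_is_subgroup by fastforce
  then show ?thesis
    using bij_betw_row_map by (simp add: bij_betw_def)
qed

lemma linear_character_row_char: "linear_character (G\<lparr>carrier := S\<rparr>) \<chi>"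
  using row_char_mult row_char_nonzero
  unfolding linear_character_def hom_def complex_mult_group_def by auto

text \<open>On \<open>S\<close>, composing \<open>col_char\<close> with \<sigma> gives \<chi>, so
  nonvanishing and multiplicativity carry over.\<close>

lemma linear_character_col_char: "linear_character (G'\<lparr>carrier := S'\<rparr>) (col_char G G' U)"
proof -
  have col: "col_char G G' U (\<sigma> a) = \<chi> a" if "a \<in> S" for a
    using that bij_betw_row_map
    by (simp add: col_char_def row_char_def bij_betw_def)
  have S': "S' = \<sigma> ` S"
    using bij_betw_row_map by (simp add: bij_betw_def)
  show ?thesis
    \<comment> \<open>With \<open>S'\<close> as an image, every argument is some
      \<open>\<sigma> a\<close>; reversing \<open>row_map_mult\<close> turns a product of two such
      into \<open>\<sigma>\<close> of a product, where \<open>col\<close> applies.\<close>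
    unfolding linear_character_def hom_def complex_mult_group_def S'
    by (auto simp: col row_char_nonzero row_char_mult mult_in_single_rows
        simp flip: row_map_mult)
qed

end

theorem theorem10p1:
  fixes G :: "('a, 'm) monoid_scheme" and G' :: "('b, 'n) monoid_scheme"
    and U :: "'a \<Rightarrow> 'b \<Rightarrow> complex"
    and S :: "'a set" and S' :: "'b set"
    and \<sigma> :: "'a \<Rightarrow> 'b" and \<chi> :: "'a \<Rightarrow> complex" and \<chi>' :: "'b \<Rightarrow> complex"
  assumes "group G" and "finite (carrier G)"
    and "group G'" and "finite (carrier G')"
    and "transformation_matrix G G' U"
  defines "S \<equiv> single_rows G G' U"
    and "S' \<equiv> single_cols G G' U"
    and "\<sigma> \<equiv> row_map G G' U"
    and "\<chi> \<equiv> row_char G G' U"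
    and "\<chi>' \<equiv> col_char G G' U"
  shows "subgroup S G \<and> subgroup S' G' \<and>
    \<sigma> \<in> iso (G\<lparr>carrier := S\<rparr>) (G'\<lparr>carrier := S'\<rparr>) \<and>
    linear_character (G\<lparr>carrier := S\<rparr>) \<chi> \<and>
    linear_character (G'\<lparr>carrier := S'\<rparr>) \<chi>'"
proof -
  interpret transformation G G' U
    using assms by (simp add: transformation_def transformation_axioms_def)
  show ?thesis
    unfolding S_def S'_def \<sigma>_def \<chi>_def \<chi>'_def
    using subgroup_single_rows subgroup_single_cols row_map_iso
      linear_character_row_char linear_character_col_char by blast
qed

end
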